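(* For any vector field $$X(x)=\sum_{i=1}^n f_i(x)\frac{\partial}{\partial x_i},$$ there exists a vector field $S$ that is $\varphi$-related to $X$, with $\varphi(x)=(x,1)$, that is homogeneous of degree $\xi\in\mathbb{R}$ with respect to the standard dilation vector field, and that is given by $$S(x,w)=\sum_{i=1}^n w^{\xi+1} f_i(w^{-1}x)\frac{\partial}{\partial x_i}.$$
   Context: All objects are smooth unless otherwise stated. Here $x=(x_1,\ldots,x_n)\in\mathbb{R}^n$ and $w\in\mathbb{R}$ is an auxiliary variable; $S$ is a vector field in the variables $(x,w)$ whose component along $\frac{\partial}{\partial w}$ is zero (so $\dot w=0$). $S$ is in general not defined for $w=0$, and it is used only at points with $w\neq 0$. The standard dilation vector field in the variables $(x,w)$ is $D=\sum_{i=1}^n x_i\frac{\partial}{\partial x_i}+w\frac{\partial}{\partial w}$. The Lie product of vector fields $X,Y$ is, in local coordinates, $[X,Y]=\frac{\partial Y}{\partial x}X-\frac{\partial X}{\partial x}Y$. A vector field $S$ is homogeneous of degree $\xi$ with respect to $D$ if $[D,S]=\xi S$. For a map $\varphi:M\to N$ with differential $T\varphi$, a vector field $X$ on $M$ and a vector field $S$ on $N$ are $\varphi$-related if $T\varphi\cdot X=S\circ\varphi$. *)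

theory Defs
  imports "HOL-Analysis.Analysis"
begin

fun C_on :: "nat \<Rightarrow> 'a::euclidean_space set \<Rightarrow> ('a \<Rightarrow> 'b::real_normed_vector) \<Rightarrow> bool" where
  "C_on 0 U f \<longleftrightarrow> continuous_on U f"
| "C_on (Suc k) U f \<longleftrightarrow>
     (\<forall>x\<in>U. f differentiable (at x)) \<and> (\<forall>v. C_on k U (\<lambda>x. frechet_derivative f (at x) v))"

definition smooth_on :: "'a::euclidean_space set \<Rightarrow> ('a \<Rightarrow> 'b::real_normed_vector) \<Rightarrow> bool" where
  "smooth_on U f \<longleftrightarrow> open U \<and> (\<forall>k. C_on k U f)"

text \<open>A vector field on an open subset of a Euclidean space is identified with the function
  assigning to each point its coordinate vector.\<close>

definition phi_related ::
  "('a::euclidean_space \<Rightarrow> 'b::euclidean_space) \<Rightarrow> 'a set \<Rightarrow> ('a \<Rightarrow> 'a) \<Rightarrow> 'b set \<Rightarrow> ('b \<Rightarrow> 'b) \<Rightarrow> bool" where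
  "phi_related \<phi> M X N S \<longleftrightarrow>
     smooth_on M \<phi> \<and> \<phi> ` M \<subseteq> N \<and> (\<forall>x\<in>M. frechet_derivative \<phi> (at x) (X x) = S (\<phi> x))"

definition lie_product :: "('a::euclidean_space \<Rightarrow> 'a) \<Rightarrow> ('a \<Rightarrow> 'a) \<Rightarrow> 'a \<Rightarrow> 'a" where
  "lie_product X Y p = frechet_derivative Y (at p) (X p) - frechet_derivative X (at p) (Y p)"

definition homogeneous_on ::
  "'a::euclidean_space set \<Rightarrow> ('a \<Rightarrow> 'a) \<Rightarrow> real \<Rightarrow> ('a \<Rightarrow> 'a) \<Rightarrow> bool" where
  "homogeneous_on U D \<xi> S \<longleftrightarrow> (\<forall>p\<in>U. lie_product D S p = \<xi> *\<^sub>R S p)"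

definition partial_x :: "'n::finite \<Rightarrow> (real^'n) \<times> real" where
  "partial_x i = (axis i 1, 0)"

definition partial_w :: "(real^'n::finite) \<times> real" where
  "partial_w = (0, 1)"

definition dilation :: "(real^'n::finite) \<times> real \<Rightarrow> (real^'n) \<times> real" where
  "dilation = (\<lambda>(x, w). (\<Sum>i\<in>UNIV. (x $ i) *\<^sub>R partial_x i) + w *\<^sub>R partial_w)"

text \<open>Real powers of a nonzero real base: for a negative base the power is a real number exactly
  when the exponent is a quotient \<open>p / q\<close> of integers with \<open>q\<close> odd (in particular for every
  integer exponent), and then it is the \<open>p\<close>-th power of the real \<open>q\<close>-th root. The library's
  \<^term>\<open>(powr)\<close> does not give this value for a negative base: it yields
  \<open>\<bar>w\<bar> powr a\<close>.\<close>

definition has_real_power :: "real \<Rightarrow> real \<Rightarrow> bool" where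
  "has_real_power w a \<longleftrightarrow>
     w > 0 \<or> (w < 0 \<and> (\<exists>(p::int) (q::nat). odd q \<and> a = of_int p / of_nat q))"

definition real_power :: "real \<Rightarrow> real \<Rightarrow> real" where
  "real_power w a =
     (if w > 0 then w powr a
      else (THE y. \<exists>(p::int) (q::nat). odd q \<and> a = of_int p / of_nat q \<and> y = root q w powi p))"

definition power_domain :: "real \<Rightarrow> ((real^'n::finite) \<times> real) set" where
  "power_domain a = {(x, w). w \<noteq> 0 \<and> has_real_power w a}"

lemma real_power_pos: "w > 0 \<Longrightarrow> real_power w a = w powr a"
  by (simp add: real_power_def)

lemma root_powi_neg:
  fixes w :: real and p :: int and q :: nat
  assumes "w < 0" "odd q"
  shows "root q w powi p = (if even p then 1 else - 1) * (- w) powr (of_int p / of_nat q)"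
proof -
  have q: "q > 0" using assms(2) by (rule odd_pos)
  have r: "root q w = - ((- w) powr (1 / of_nat q))"
    using assms q root_powr_inverse[of q "- w"] real_root_minus[of q w] by simp
  have "((- w) powr (1 / of_nat q)) powi p = (- w) powr (of_int p / of_nat q)"
    using assms by (simp add: powr_real_of_int' [symmetric] powr_powr)
  then show ?thesis
    unfolding r by (simp add: power_int_minus_left)
qed

lemma real_power_neg:
  fixes w :: real and p :: int and q :: nat
  assumes "w < 0" "odd q"
  shows "real_power w (of_int p / of_nat q) = root q w powi p"
proof -
  have "root q' w powi p' = root q w powi p"
    if "odd q'" "of_int p / of_nat q = (of_int p' / of_nat q' :: real)" for p' :: int and q' :: nat
  proof -
    have "q > 0" "q' > 0" using assms(2) that(1) by (auto intro: odd_pos)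
    then have "real_of_int (p * int q') = real_of_int (p' * int q)"
      using that(2) by (simp add: field_simps)
    then have "p * int q' = p' * int q" by (simp only: of_int_eq_iff)
    then have "even (p * int q') \<longleftrightarrow> even (p' * int q)" by simp
    then have "even p \<longleftrightarrow> even p'" using assms(2) that(1) by simp
    then show ?thesis using assms that by (simp add: root_powi_neg)
  qed
  then have "(THE y. \<exists>(p'::int) (q'::nat). odd q' \<and> real_of_int p / real q = of_int p' / of_nat q'
      \<and> y = root q' w powi p') = root q w powi p"
    using assms(2) by (intro the_equality) blast+
  moreover have "\<not> w > 0" using assms(1) by simp
  ultimately show ?thesis
    unfolding real_power_def by (simp only: if_False)
qed

lemma real_power_int:
  assumes "w \<noteq> 0"
  shows "has_real_power w (of_int k)" "real_power w (of_int k) = w powi k"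
proof -
  have "odd (1::nat) \<and> real_of_int k = of_int k / of_nat 1" by simp
  then have k: "\<exists>(p::int) (q::nat). odd q \<and> real_of_int k = of_int p / of_nat q" by blast
  show "has_real_power w (of_int k)"
    using k neq_iff[THEN iffD1, OF assms] unfolding has_real_power_def by blast
  show "real_power w (of_int k) = w powi k"
  proof (cases "w > 0")
    case True
    then show ?thesis by (simp add: real_power_pos powr_real_of_int')
  next
    case False
    then show ?thesis using real_power_neg[of w 1 k] assms by simp
  qed
qed

end

theory Submission imports Defs
begin

text \<open>
  Every \<open>Y\<close> on the hyperplane \<open>w = 1\<close> extends to \<open>H a Y (x, w) = w\<^sup>a Y (x / w)\<close>, which is
  homogeneous of degree \<open>a\<close> along rays. The vector field of the theorem is this extension of
  \<open>(X, 0)\<close> with \<open>a = \<xi> + 1\<close>, so it restricts to \<open>(X, 0)\<close> on the hyperplane, and this is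
  \<open>\<phi>\<close>-relatedness. The dilation field is the identity map \<open>p \<mapsto> p\<close>, hence
  \<open>[D, S] p = DS(p) p - S p\<close>. Euler's identity (\<open>homogeneous_extension_Euler\<close>) turns this into
  \<open>(\<xi> + 1) S p - S p = \<xi> S p\<close>; the degree as a vector field is one less than the degree as a
  function.

  The work lies in the smoothness of \<open>H a Y\<close>, including the half space \<open>w < 0\<close> when \<open>a\<close> is a
  rational number with odd denominator. Instead of composing and multiplying smooth maps, the
  proof uses that the extensions of smooth maps are closed under differentiation up to linear
  combinations: in the direction \<open>(v, u)\<close>,
  \<open>D (H a Y) = u a H (a - 1) Y + H (a - 1) (DY v) - u H (a - 1) (EY)\<close>
  with the radial derivative \<open>EY y = DY(y) y\<close>
  (\<open>has_derivative_homogeneous_extension\<close>). An induction on the order of differentiability over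
  all \<open>a\<close> and \<open>Y\<close> then suffices, once \<open>EY\<close> is known to be smooth
  (\<open>smooth_on_radial_derivative\<close>). The exponent may be lowered by one without leaving the
  domain, because \<open>a\<close> and \<open>a - 1\<close> have the same denominator
  (\<open>power_domain_diff_one\<close>).
\<close>

section \<open>Closure properties of smooth maps\<close>

text \<open>The defining recursion of \<open>C_on\<close> refers to derivatives in the whole space. They depend only
  on the values in a neighbourhood, which is where openness enters.\<close>

lemma C_on_cong:
  assumes "open U" "\<And>x. x \<in> U \<Longrightarrow> f x = g x"
  shows "C_on k U f \<longleftrightarrow> C_on k U g"
proof -
  have *: "C_on k U g" if "\<And>x. x \<in> U \<Longrightarrow> f x = g x" "C_on k U f" for f g
    using that
  proof (induction k arbitrary: f g)
    case 0
    then show ?case using continuous_on_cong[of U U f g] by simp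
  next
    case (Suc k)
    have der: "(g has_derivative frechet_derivative f (at x)) (at x)" if "x \<in> U" for x
    proof (rule has_derivative_transform_within_open[OF _ assms(1) that])
      show "(f has_derivative frechet_derivative f (at x)) (at x)"
        using Suc.prems(2) that by (simp add: frechet_derivative_works)
    qed (use Suc.prems(1) in auto)
    have eq: "frechet_derivative f (at x) v = frechet_derivative g (at x) v" if "x \<in> U" for x v
      using frechet_derivative_at[OF der[OF that]] by simp
    have "C_on k U (\<lambda>x. frechet_derivative g (at x) v)" for v
      by (rule Suc.IH[OF eq]) (use Suc.prems(2) in auto)
    then show ?case using der by (auto simp: differentiable_def)
  qed
  show ?thesis using *[of f g] *[of g f] assms(2) by auto
qed

text \<open>This permits any explicit formula for the derivative on \<open>U\<close> in place of
  \<^const>\<open>frechet_derivative\<close>; all later inductions on the order use it.\<close>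

lemma C_on_SucI:
  assumes "open U" "\<And>x. x \<in> U \<Longrightarrow> (f has_derivative f' x) (at x)"
    and "\<And>v. C_on k U (\<lambda>x. f' x v)"
  shows "C_on (Suc k) U f"
proof -
  have "C_on k U (\<lambda>x. frechet_derivative f (at x) v)" for v
    using C_on_cong[OF assms(1), of "\<lambda>x. frechet_derivative f (at x) v" "\<lambda>x. f' x v" k]
      frechet_derivative_at[OF assms(2)] assms(3) by metis
  then show ?thesis using assms(2) by (auto simp: differentiable_def)
qed

lemma smooth_on_has_derivative:
  assumes "smooth_on U f" "x \<in> U"
  shows "(f has_derivative frechet_derivative f (at x)) (at x)"
proof -
  have "C_on (Suc 0) U f" using assms(1) unfolding smooth_on_def by blast
  then show ?thesis using assms(2) by (simp add: frechet_derivative_works)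
qed

lemma smooth_on_directional_derivative:
  assumes "smooth_on U f"
  shows "smooth_on U (\<lambda>x. frechet_derivative f (at x) v)"
  using assms unfolding smooth_on_def by (metis C_on.simps(2))

lemma smooth_on_const: "open U \<Longrightarrow> smooth_on U (\<lambda>x. c)"
proof -
  assume U: "open U"
  have "C_on k U (\<lambda>x. c)" for k
  proof (induction k arbitrary: c)
    case (Suc k)
    show ?case by (rule C_on_SucI[OF U, where f' = "\<lambda>x v. 0"]) (use Suc in auto)
  qed simp
  then show ?thesis using U by (simp add: smooth_on_def)
qed

lemma C_on_add:
  assumes U: "open U" and "C_on k U f" "C_on k U g"
  shows "C_on k U (\<lambda>x. f x + g x)"
  using assms(2,3)
proof (induction k arbitrary: f g)
  case 0
  then show ?case by (simp add: continuous_on_add)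
next
  case (Suc k)
  show ?case
    by (rule C_on_SucI[OF U, where
          f' = "\<lambda>x v. frechet_derivative f (at x) v + frechet_derivative g (at x) v"])
      (use Suc in \<open>auto intro!: has_derivative_add simp flip: frechet_derivative_works\<close>)
qed

lemma C_on_bounded_linear_compose:
  assumes U: "open U" and L: "bounded_linear L" and "C_on k U f"
  shows "C_on k U (\<lambda>x. L (f x))"
  using assms(3)
proof (induction k arbitrary: f)
  case 0
  then show ?case by (simp add: L bounded_linear.continuous_on)
next
  case (Suc k)
  show ?case
    by (rule C_on_SucI[OF U, where f' = "\<lambda>x v. L (frechet_derivative f (at x) v)"])
      (use Suc in \<open>auto intro!: bounded_linear.has_derivative[OF L]
        simp flip: frechet_derivative_works\<close>)
qed

lemma smooth_on_bounded_linear_compose: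
  "bounded_linear L \<Longrightarrow> smooth_on U f \<Longrightarrow> smooth_on U (\<lambda>x. L (f x))"
  by (simp add: smooth_on_def C_on_bounded_linear_compose)

lemma smooth_on_sum:
  assumes U: "open U" and "\<And>i. i \<in> I \<Longrightarrow> smooth_on U (f i)"
  shows "smooth_on U (\<lambda>x. \<Sum>i\<in>I. f i x)"
  using assms(2)
proof (induction I rule: infinite_finite_induct)
  case (insert i I)
  then have "smooth_on U (f i)" "smooth_on U (\<lambda>x. \<Sum>i\<in>I. f i x)" by blast+
  then show ?case using insert.hyps by (simp add: smooth_on_def C_on_add)
qed (simp_all add: smooth_on_const U)

text \<open>Each differentiation either hits the linear factor, which leaves a constant multiple of
  \<open>g\<close>, or hits \<open>g\<close>, which leaves a product of the same shape. The induction therefore has to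
  range over all smooth \<open>g\<close>, but needs no general product rule for higher derivatives.\<close>

lemma smooth_on_linear_scaleR:
  assumes l: "bounded_linear l" and "smooth_on U g"
  shows "smooth_on U (\<lambda>x. l x *\<^sub>R g x)"
proof -
  have U: "open U" using assms(2) by (simp add: smooth_on_def)
  have "C_on k U (\<lambda>x. l x *\<^sub>R g x)" for k
    using assms(2)
  proof (induction k arbitrary: g)
    case 0
    then have "continuous_on U g" unfolding smooth_on_def by (metis C_on.simps(1))
    then show ?case
      by (simp add: continuous_on_scaleR bounded_linear.continuous_on[OF l] continuous_on_id)
  next
    case (Suc k)
    show ?case
    proof (rule C_on_SucI[OF U])
      show "((\<lambda>x. l x *\<^sub>R g x) has_derivative
          (\<lambda>v. l x *\<^sub>R frechet_derivative g (at x) v + l v *\<^sub>R g x)) (at x)" if "x \<in> U" for x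
        by (intro has_derivative_scaleR bounded_linear_imp_has_derivative l
            smooth_on_has_derivative[OF Suc.prems that])
      show "C_on k U (\<lambda>x. l x *\<^sub>R frechet_derivative g (at x) v + l v *\<^sub>R g x)" for v
        using Suc.IH[OF smooth_on_directional_derivative[OF Suc.prems, of v]]
          smooth_on_bounded_linear_compose[OF bounded_linear_scaleR_right Suc.prems, of "l v"]
        by (intro C_on_add U) (auto simp: smooth_on_def)
    qed
  qed
  then show ?thesis using U by (simp add: smooth_on_def)
qed

text \<open>The radial derivative is smooth because, expanded in an orthonormal basis, it is the sum
  of the partial derivatives multiplied by the coordinate functions.\<close>

lemma smooth_on_radial_derivative:
  assumes "smooth_on U g"
  shows "smooth_on U (\<lambda>y. frechet_derivative g (at y) y)"
proof -
  have U: "open U" using assms by (simp add: smooth_on_def)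
  have eq: "(\<Sum>i\<in>Basis. (y \<bullet> i) *\<^sub>R frechet_derivative g (at y) i) = frechet_derivative g (at y) y"
    if "y \<in> U" for y
  proof -
    let ?D = "frechet_derivative g (at y)"
    have D: "linear ?D"
      using smooth_on_has_derivative[OF assms that] by (rule has_derivative_linear)
    have "?D (\<Sum>i\<in>Basis. (y \<bullet> i) *\<^sub>R i) = (\<Sum>i\<in>Basis. (y \<bullet> i) *\<^sub>R ?D i)"
      by (simp only: linear_sum[OF D] linear_scale[OF D])
    then show ?thesis by (simp only: euclidean_representation)
  qed
  have "smooth_on U (\<lambda>y. \<Sum>i\<in>Basis. (y \<bullet> i) *\<^sub>R frechet_derivative g (at y) i)"
    by (intro smooth_on_sum smooth_on_linear_scaleR smooth_on_directional_derivative assms U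
        bounded_linear_inner_left)
  then show ?thesis
    unfolding smooth_on_def using C_on_cong[OF U, OF eq] by simp
qed

section \<open>Real powers\<close>

text \<open>On the negative half-line the real power is a constant \<open>c = \<plusminus> 1\<close> times
  \<open>\<bar>v\<bar> powr a\<close>. Lowering the exponent by one lowers the numerator by the odd denominator, which
  changes its parity and so the sign. The constant is the same for all \<open>v\<close>, which is what makes
  it possible to differentiate.\<close>

lemma real_power_neg_powr:
  assumes "has_real_power w a" "w < 0"
  obtains c where "\<And>v. v < 0 \<Longrightarrow> real_power v a = c * (- v) powr a"
    "\<And>v. v < 0 \<Longrightarrow> real_power v (a - 1) = - c * (- v) powr (a - 1)"
proof -
  obtain p :: int and q :: nat where q: "odd q" and a: "a = of_int p / of_nat q"
    using assms unfolding has_real_power_def by auto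
  have "q > 0" using q by (rule odd_pos)
  then have a1: "a - 1 = of_int (p - int q) / of_nat q"
    by (simp add: a field_simps)
  let ?c = "(if even p then 1 else - 1) :: real"
  show thesis
  proof
    show "real_power v a = ?c * (- v) powr a" if "v < 0" for v
      unfolding a using real_power_neg[OF that q] root_powi_neg[OF that q] by simp
    show "real_power v (a - 1) = - ?c * (- v) powr (a - 1)" if "v < 0" for v
      unfolding a1 real_power_neg[OF that q] root_powi_neg[OF that q] using q by simp
  qed
qed

lemma real_power_diff_one:
  assumes "w \<noteq> 0" "has_real_power w a"
  shows "w * real_power w (a - 1) = real_power w a"
proof (cases "w > 0")
  case True
  then show ?thesis by (simp add: real_power_pos powr_diff)
next
  case False
  with assms have w: "w < 0" by simp
  obtain c where "\<And>v. v < 0 \<Longrightarrow> real_power v a = c * (- v) powr a"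
    "\<And>v. v < 0 \<Longrightarrow> real_power v (a - 1) = - c * (- v) powr (a - 1)"
    using real_power_neg_powr[OF assms(2) w] by metis
  then show ?thesis using w by (simp add: powr_diff)
qed

lemma has_real_derivative_real_power:
  assumes "w \<noteq> 0" "has_real_power w a"
  shows "((\<lambda>w. real_power w a) has_real_derivative a * real_power w (a - 1)) (at w)"
proof (cases "w > 0")
  case True
  have "((\<lambda>w. w powr a) has_real_derivative a * w powr (a - 1)) (at w)"
    by (rule has_real_derivative_powr[OF True])
  then have "((\<lambda>w. real_power w a) has_real_derivative a * w powr (a - 1)) (at w)"
    by (rule has_field_derivative_transform_within_open[where S = "{0<..}"])
      (use True in \<open>auto simp: real_power_pos\<close>)
  then show ?thesis using True by (simp add: real_power_pos)
next
  case False
  with assms have w: "w < 0" by simp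
  obtain c where c: "\<And>v. v < 0 \<Longrightarrow> real_power v a = c * (- v) powr a"
    "\<And>v. v < 0 \<Longrightarrow> real_power v (a - 1) = - c * (- v) powr (a - 1)"
    using real_power_neg_powr[OF assms(2) w] by metis
  have "((\<lambda>w. c * (- w) powr a) has_real_derivative c * (a * (- w) powr (a - 1) * - 1)) (at w)"
    using w by (intro DERIV_cmult DERIV_chain2[OF has_real_derivative_powr] derivative_eq_intros) auto
  then have "((\<lambda>w. real_power w a) has_real_derivative c * (a * (- w) powr (a - 1) * - 1)) (at w)"
    by (rule has_field_derivative_transform_within_open[where S = "{..<0}"])
      (use w c in auto)
  then show ?thesis using w c(2) by (simp add: algebra_simps)
qed

text \<open>Whether a power of a negative number exists depends only on the denominator of the exponent,
  which an integer shift preserves.\<close>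

lemma has_real_power_diff_one: "has_real_power w (a - 1) \<longleftrightarrow> has_real_power w a"
proof -
  have shift: "\<exists>(p::int) (q::nat). odd q \<and> b + of_int k = of_int p / of_nat q"
    if rational: "\<exists>(p::int) (q::nat). odd q \<and> b = of_int p / of_nat q" for b :: real and k :: int
  proof -
    obtain p :: int and q :: nat where q: "odd q" and b: "b = of_int p / of_nat q"
      using rational by blast
    have "q > 0" using q by (rule odd_pos)
    then have "b + of_int k = of_int (p + k * int q) / of_nat q" by (simp add: b field_simps)
    with q show ?thesis by blast
  qed
  show ?thesis
    using shift[of a "-1"] shift[of "a - 1" 1] unfolding has_real_power_def by auto
qed

lemma power_domain_diff_one: "power_domain (a - 1) = power_domain a"
  by (simp add: power_domain_def has_real_power_diff_one)

text \<open>Existence of a power depends on the base only through its sign, so \<open>-1\<close> decides for all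
  negative bases.\<close>

lemma open_power_domain: "open (power_domain a)"
proof -
  have *: "power_domain a = UNIV \<times> (if has_real_power (-1) a then - {0} else {0<..})"
    by (auto simp: power_domain_def has_real_power_def)
  show ?thesis unfolding * by (intro open_Times) auto
qed

section \<open>Homogeneous extensions\<close>

definition homogeneous_extension ::
  "real \<Rightarrow> (real^'n \<Rightarrow> 'b::real_normed_vector) \<Rightarrow> (real^'n::finite) \<times> real \<Rightarrow> 'b" where
  "homogeneous_extension a Y = (\<lambda>(x, w). real_power w a *\<^sub>R Y (inverse w *\<^sub>R x))"

text \<open>The derivative of the inner map \<open>(x, w) \<mapsto> x / w\<close> at \<open>(x, w)\<close> is
  \<open>(v, u) \<mapsto> (v - u y) / w\<close> with \<open>y = x / w\<close>. The factor \<open>1 / w\<close> combines with \<open>w\<^sup>a\<close> to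
  \<open>w\<close> to the power \<open>a - 1\<close>, and the base point survives only as the argument \<open>y\<close>. So the result
  consists again of homogeneous extensions, all of degree \<open>a - 1\<close>.\<close>

lemma has_derivative_homogeneous_extension:
  assumes Y: "smooth_on UNIV Y" and p: "p \<in> power_domain a"
  shows "(homogeneous_extension a Y has_derivative
    (\<lambda>(v, u). (u * a) *\<^sub>R homogeneous_extension (a - 1) Y p
       + homogeneous_extension (a - 1) (\<lambda>y. frechet_derivative Y (at y) v) p
       + (- u) *\<^sub>R homogeneous_extension (a - 1) (\<lambda>y. frechet_derivative Y (at y) y) p)) (at p)"
proof -
  obtain x w where [simp]: "p = (x, w)" by (cases p)
  have w: "w \<noteq> 0" "has_real_power w a" using p by (auto simp: power_domain_def)
  let ?y = "inverse w *\<^sub>R x"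
  let ?DY = "frechet_derivative Y (at ?y)"
  have DY: "(Y has_derivative ?DY) (at ?y)" by (rule smooth_on_has_derivative[OF Y]) simp
  interpret DY: bounded_linear ?DY using DY by (rule has_derivative_bounded_linear)
  have pow: "((\<lambda>q. real_power (snd q) a) has_derivative
      (\<lambda>h. (a * real_power w (a - 1)) * snd h)) (at p)"
    by (rule has_derivative_compose[OF has_derivative_snd[OF has_derivative_ident], of
          "\<lambda>w. real_power w a", simplified])
      (use has_real_derivative_real_power[OF w] in \<open>simp add: has_field_derivative_def\<close>)
  have inner: "((\<lambda>q. inverse (snd q) *\<^sub>R fst q) has_derivative
      (\<lambda>h. inverse w *\<^sub>R (fst h - snd h *\<^sub>R ?y))) (at p)"
    using w by (auto intro!: derivative_eq_intros simp: fun_eq_iff algebra_simps)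
  have Yin: "((\<lambda>q. Y (inverse (snd q) *\<^sub>R fst q)) has_derivative
      (\<lambda>h. ?DY (inverse w *\<^sub>R (fst h - snd h *\<^sub>R ?y)))) (at p)"
    by (rule has_derivative_compose[OF inner]) (use DY in simp)
  have "((\<lambda>q. real_power (snd q) a *\<^sub>R Y (inverse (snd q) *\<^sub>R fst q)) has_derivative
      (\<lambda>h. real_power w a *\<^sub>R ?DY (inverse w *\<^sub>R (fst h - snd h *\<^sub>R ?y))
         + (a * real_power w (a - 1) * snd h) *\<^sub>R Y ?y)) (at p)"
    using has_derivative_scaleR[OF pow Yin] by simp
  moreover have "real_power w a *\<^sub>R ?DY (inverse w *\<^sub>R (v - u *\<^sub>R ?y))
      = real_power w (a - 1) *\<^sub>R ?DY v - (u * real_power w (a - 1)) *\<^sub>R ?DY ?y" for v u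
  proof -
    have "real_power w a * inverse w = real_power w (a - 1)"
      using real_power_diff_one[OF w] w by (simp add: field_simps)
    then have "real_power w a *\<^sub>R ?DY (inverse w *\<^sub>R (v - u *\<^sub>R ?y))
        = real_power w (a - 1) *\<^sub>R ?DY (v - u *\<^sub>R ?y)"
      by (simp only: DY.scaleR scaleR_scaleR)
    also have "\<dots> = real_power w (a - 1) *\<^sub>R (?DY v - u *\<^sub>R ?DY ?y)"
      by (simp only: DY.diff DY.scaleR)
    finally show ?thesis by (simp only: scaleR_diff_right scaleR_scaleR mult.commute)
  qed
  ultimately have "((\<lambda>q. real_power (snd q) a *\<^sub>R Y (inverse (snd q) *\<^sub>R fst q)) has_derivative
      (\<lambda>h. (real_power w (a - 1) *\<^sub>R ?DY (fst h) - (snd h * real_power w (a - 1)) *\<^sub>R ?DY ?y)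
         + (a * real_power w (a - 1) * snd h) *\<^sub>R Y ?y)) (at p)"
    by (simp only:)
  then show ?thesis
    unfolding homogeneous_extension_def by (simp add: case_prod_beta' algebra_simps)
qed

lemma smooth_on_homogeneous_extension:
  assumes "smooth_on UNIV Y"
  shows "smooth_on (power_domain a) (homogeneous_extension a Y)"
proof -
  have "C_on k (power_domain a) (homogeneous_extension a Y)" for k
    using assms
  proof (induction k arbitrary: a Y)
    case 0
    have "continuous_on (power_domain a) (homogeneous_extension a Y)"
      using has_derivative_continuous[OF has_derivative_homogeneous_extension[OF 0]]
      by (intro continuous_at_imp_continuous_on) blast
    then show ?case by simp
  next
    case (Suc k)
    \<comment> \<open>The domain does not change with the degree, so the hypothesis for \<open>a - 1\<close> applies on the
      same set.\<close>
    note ext = Suc.IH[of _ "a - 1", unfolded power_domain_diff_one]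
    show ?case
    proof (rule C_on_SucI[OF open_power_domain has_derivative_homogeneous_extension[OF Suc.prems]])
      fix h :: "(real^'a) \<times> real"
      show "C_on k (power_domain a) (\<lambda>p. case h of (v, u) \<Rightarrow>
        (u * a) *\<^sub>R homogeneous_extension (a - 1) Y p
       + homogeneous_extension (a - 1) (\<lambda>y. frechet_derivative Y (at y) v) p
       + (- u) *\<^sub>R homogeneous_extension (a - 1) (\<lambda>y. frechet_derivative Y (at y) y) p)"
        unfolding case_prod_beta
        by (intro C_on_add open_power_domain ext Suc.prems smooth_on_directional_derivative
            smooth_on_radial_derivative
            C_on_bounded_linear_compose[OF _ bounded_linear_scaleR_right])
    qed
  qed
  then show ?thesis by (simp add: smooth_on_def open_power_domain)
qed

text \<open>This is Euler's identity for functions of degree \<open>a\<close>. Along the ray through \<open>p\<close> the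
  argument \<open>x / w\<close> does not change, which is why the two terms of the derivative that contain the
  derivative of \<open>Y\<close> cancel.\<close>

lemma homogeneous_extension_Euler:
  assumes "smooth_on UNIV Y" "p \<in> power_domain a"
  shows "frechet_derivative (homogeneous_extension a Y) (at p) p = a *\<^sub>R homogeneous_extension a Y p"
proof -
  obtain x w where [simp]: "p = (x, w)" by (cases p)
  have w: "w \<noteq> 0" "has_real_power w a" using assms(2) by (auto simp: power_domain_def)
  let ?y = "inverse w *\<^sub>R x"
  have "linear (frechet_derivative Y (at ?y))"
    by (rule has_derivative_linear[OF smooth_on_has_derivative[OF assms(1)]]) simp
  then have "w *\<^sub>R frechet_derivative Y (at ?y) ?y = frechet_derivative Y (at ?y) (w *\<^sub>R ?y)"
    by (simp only: linear_scale)
  also have "w *\<^sub>R ?y = x" using w by simp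
  finally have radial: "frechet_derivative Y (at ?y) x = w *\<^sub>R frechet_derivative Y (at ?y) ?y" ..
  have "frechet_derivative (homogeneous_extension a Y) (at p) p
      = (w * a) *\<^sub>R real_power w (a - 1) *\<^sub>R Y ?y
        + real_power w (a - 1) *\<^sub>R frechet_derivative Y (at ?y) x
        + (- w) *\<^sub>R real_power w (a - 1) *\<^sub>R frechet_derivative Y (at ?y) ?y"
    unfolding frechet_derivative_at[OF has_derivative_homogeneous_extension[OF assms], symmetric]
    by (simp add: homogeneous_extension_def)
  also have "\<dots> = a *\<^sub>R (w * real_power w (a - 1)) *\<^sub>R Y ?y"
    unfolding radial by (simp add: mult.commute mult.left_commute)
  also have "\<dots> = a *\<^sub>R homogeneous_extension a Y p"
    by (simp add: homogeneous_extension_def real_power_diff_one[OF w])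
  finally show ?thesis .
qed

section \<open>The homogenised vector field\<close>

lemma dilation_eq_id: "dilation = (\<lambda>p :: (real^'n::finite) \<times> real. p)"
proof -
  have "dilation (x, w) = (x, w)" for x :: "real^'n" and w :: real
    by (simp add: dilation_def partial_x_def partial_w_def prod_eq_iff fst_sum snd_sum
        vec_eq_iff axis_def if_distrib cong: if_cong)
  then show ?thesis by auto
qed

theorem mainTheorem1:
  fixes X :: "real^'n::finite \<Rightarrow> real^'n"
    and f :: "'n \<Rightarrow> real^'n \<Rightarrow> real"
    and \<xi> :: real
  assumes "smooth_on UNIV X"
    and "\<And>x. X x = (\<Sum>i\<in>UNIV. f i x *\<^sub>R axis i 1)"
  shows "\<exists>S :: (real^'n) \<times> real \<Rightarrow> (real^'n) \<times> real.
    smooth_on (power_domain (\<xi> + 1)) S \<and>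
    (\<forall>p\<in>power_domain (\<xi> + 1). snd (S p) = 0) \<and>
    phi_related (\<lambda>x. (x, 1)) UNIV X (power_domain (\<xi> + 1)) S \<and>
    homogeneous_on (power_domain (\<xi> + 1)) dilation \<xi> S \<and>
    (\<forall>(x, w)\<in>power_domain (\<xi> + 1).
       S (x, w) = (\<Sum>i\<in>UNIV. (real_power w (\<xi> + 1) * f i (inverse w *\<^sub>R x)) *\<^sub>R partial_x i))"
proof -
  let ?a = "\<xi> + 1"
  let ?L = "\<lambda>v :: real^'n. (v, 0 :: real)"
  have L: "bounded_linear ?L"
    by (intro bounded_linear_Pair bounded_linear_ident bounded_linear_zero)
  define Y where "Y x = ?L (X x)" for x
  define S where "S = homogeneous_extension ?a Y"
  have Y: "smooth_on UNIV Y"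
    unfolding Y_def by (rule smooth_on_bounded_linear_compose[OF L assms(1)])
  have smooth: "smooth_on (power_domain ?a) S"
    unfolding S_def by (rule smooth_on_homogeneous_extension[OF Y])
  have horizontal: "snd (S p) = 0" for p
    by (simp add: S_def homogeneous_extension_def Y_def split_beta)
  have deriv_phi: "((\<lambda>x :: real^'n. (x, 1 :: real)) has_derivative ?L) (at x)" for x
    by (intro has_derivative_Pair has_derivative_ident has_derivative_const)
  have "C_on k UNIV (\<lambda>x :: real^'n. (x, 1 :: real))" for k
  proof (cases k)
    case 0
    then show ?thesis by (simp add: continuous_on_Pair)
  next
    case (Suc m)
    have "smooth_on UNIV (\<lambda>x :: real^'n. ?L v)" for v
      by (rule smooth_on_const) simp
    then have "C_on m UNIV (\<lambda>x :: real^'n. ?L v)" for v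
      by (simp add: smooth_on_def)
    then show ?thesis
      unfolding Suc by (intro C_on_SucI[OF open_UNIV deriv_phi])
  qed
  then have related: "phi_related (\<lambda>x. (x, 1)) UNIV X (power_domain ?a) S"
    by (auto simp: phi_related_def smooth_on_def power_domain_def has_real_power_def S_def
        homogeneous_extension_def Y_def real_power_pos
        simp flip: frechet_derivative_at[OF deriv_phi])
  have homogeneous: "homogeneous_on (power_domain ?a) dilation \<xi> S"
    unfolding homogeneous_on_def lie_product_def dilation_eq_id S_def
    using homogeneous_extension_Euler[OF Y] by (simp add: frechet_derivative_ident algebra_simps)
  have "Y x = (\<Sum>i\<in>UNIV. f i x *\<^sub>R partial_x i)" for x
    unfolding Y_def assms(2)
    by (simp add: partial_x_def prod_eq_iff fst_sum snd_sum)
  then have "S (x, w) = (\<Sum>i\<in>UNIV. (real_power w ?a * f i (inverse w *\<^sub>R x)) *\<^sub>R partial_x i)" for x w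
    by (simp add: S_def homogeneous_extension_def scaleR_sum_right)
  with smooth horizontal related homogeneous show ?thesis by blast
qed

end
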